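(* Let $N\ge1$, $0<p<1$, $\mu\ne0$, and assume $-\mu^*<\mu<\frac14$, or equivalently $\beta_+<\frac{2}{1-p}$. Then there exists no positive radial solution $u=u(\delta)$ of $\Delta u+\frac{\mu}{\delta^2}u=u^p$ near the outer boundary $r=R$ of a ball or annulus, or near the inner boundary $r=r_0>0$ of an annulus, for which $$\lim_{\delta\to0}u(\delta)\,\delta^{\frac{2}{p-1}}=\infty\qquad\text{and}\qquad\lim_{\delta\to0}u(\delta)\,\delta^{-\beta_+}=0.$$
   Context: $\mu^*=\frac{2(p+1)}{(1-p)^2}$, $\beta_+=\frac12+\sqrt{\frac14-\mu}$. The ball is $B_R=\{|x|<R\}\subset\mathbb{R}^N$, the annulus is $\{r_0<|x|<R\}$, and $\delta$ is the distance to the boundary: $\delta=R-r$ near the outer boundary, $\delta=r-r_0$ near the inner boundary, $r=|x|$. Radial solutions satisfy $u''+\frac{N-1}{r}u'+\frac{\mu}{\delta^2}u=u^p$ (derivatives in $r$); a solution near the boundary is one defined for $0<\delta<\delta_0$ for some $\delta_0>0$, regarded as a function of $\delta$. *)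

theory Defs
  imports "HOL-Analysis.Analysis"
begin

definition mu_star :: "real \<Rightarrow> real"
  where "mu_star p = 2 * (p + 1) / (1 - p)\<^sup>2"

definition beta_plus :: "real \<Rightarrow> real"
  where "beta_plus \<mu> = 1/2 + sqrt (1/4 - \<mu>)"

definition annulus :: "real \<Rightarrow> real \<Rightarrow> 'a::real_normed_vector set"
  where "annulus r\<^sub>0 R = {x. r\<^sub>0 < norm x \<and> norm x < R}"

definition partial_deriv :: "'a::real_vector \<Rightarrow> ('a \<Rightarrow> real) \<Rightarrow> 'a \<Rightarrow> real"
  where "partial_deriv b f x = deriv (\<lambda>t. f (x + t *\<^sub>R b)) 0"

definition C1_on :: "('a::euclidean_space \<Rightarrow> real) \<Rightarrow> 'a set \<Rightarrow> bool"
  where "C1_on f S \<longleftrightarrow>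
    (\<forall>b\<in>Basis. (\<forall>x\<in>S. (\<lambda>t. f (x + t *\<^sub>R b)) differentiable (at 0)) \<and>
                continuous_on S (partial_deriv b f))"

definition C2_on :: "('a::euclidean_space \<Rightarrow> real) \<Rightarrow> 'a set \<Rightarrow> bool"
  where "C2_on f S \<longleftrightarrow> C1_on f S \<and> (\<forall>b\<in>Basis. C1_on (partial_deriv b f) S)"

definition laplacian :: "('a::euclidean_space \<Rightarrow> real) \<Rightarrow> 'a \<Rightarrow> real"
  where "laplacian f x = (\<Sum>b\<in>Basis. partial_deriv b (partial_deriv b f) x)"

text \<open>The distance \<open>\<delta>\<close> to the boundary, by its expression near the outer boundary \<open>|x| = R\<close>
  and near the inner boundary \<open>|x| = r\<^sub>0\<close>.\<close>

definition delta_outer :: "real \<Rightarrow> 'a::real_normed_vector \<Rightarrow> real"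
  where "delta_outer R x = R - norm x"

definition delta_inner :: "real \<Rightarrow> 'a::real_normed_vector \<Rightarrow> real"
  where "delta_inner r\<^sub>0 x = norm x - r\<^sub>0"

text \<open>The profile \<open>u\<close> is a function of \<open>\<delta>\<close>; the radial solution in the \<open>x\<close> variable
  is \<open>u (\<delta> x)\<close>. Every \<open>\<delta>\<close> used below is positive on \<open>\<Omega>\<close>, so the set on which
  the equation is imposed is \<open>0 < \<delta> < \<delta>\<^sub>0\<close> in \<open>\<Omega>\<close>.\<close>

definition positive_radial_solution_near ::
    "('a::euclidean_space) set \<Rightarrow> ('a \<Rightarrow> real) \<Rightarrow> real \<Rightarrow> real \<Rightarrow> (real \<Rightarrow> real) \<Rightarrow> bool"
  where "positive_radial_solution_near \<Omega> \<delta> \<mu> p u \<longleftrightarrow>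
    (\<exists>\<delta>\<^sub>0>0. let S = {x\<in>\<Omega>. \<delta> x < \<delta>\<^sub>0}; U = (\<lambda>x. u (\<delta> x)) in
       C2_on U S \<and>
       (\<forall>x\<in>S. U x > 0 \<and> laplacian U x + \<mu> / (\<delta> x)\<^sup>2 * U x = U x powr p))"

definition intermediate_decay :: "real \<Rightarrow> real \<Rightarrow> (real \<Rightarrow> real) \<Rightarrow> bool"
  where "intermediate_decay \<mu> p u \<longleftrightarrow>
    filterlim (\<lambda>d. u d * d powr (2 / (p - 1))) at_top (at_right 0) \<and>
    ((\<lambda>d. u d * d powr (- beta_plus \<mu>)) \<longlongrightarrow> 0) (at_right 0)"

end

theory Submission
  imports Defs
begin

text \<open>In the variable \<open>\<delta>\<close> the equation reads
  \<open>u'' + (P'/P) u' + \<mu>/\<delta>\<^sup>2 u = u\<^sup>p\<close> with \<open>P = r\<^bsup>N-1\<^esup>\<close>. Write \<open>u = \<phi> v\<close>, where \<open>\<phi>\<close> behaves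
  like \<open>\<delta>\<^bsup>\<beta>\<^esup>\<close>, \<open>\<beta> = \<beta>\<^sub>+\<close>, and is a supersolution of the linear part. Then
  \<open>W = P \<phi>\<^sup>2 v'\<close> is nondecreasing. If \<open>v \<rightarrow> 0\<close>, positivity of \<open>v\<close> forces \<open>W \<rightarrow> 0\<close> at the boundary, so
  \<open>v\<close> increases, and integrating \<open>W'\<close> from 0 gives
  \<open>v' \<le> C (\<delta>\<^bsup>1-\<beta>(1-p)\<^esup> v\<^sup>p + v)\<close>. Since \<open>\<beta> < 2/(1-p)\<close> and \<open>v\<^bsup>1-p\<^esup>\<close> vanishes at 0, a Gronwall
  argument yields \<open>v\<^bsup>1-p\<^esup> = O(\<delta>\<^bsup>2-\<beta>(1-p)\<^esup>)\<close>, that is \<open>u = O(\<delta>\<^bsup>2/(1-p)\<^esup>)\<close>, which contradicts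
  the first limit.\<close>

section \<open>Growth estimates for a degenerate first-order system on (0, h)\<close>

text \<open>Since \<open>F\<close> is nonincreasing on (0, \<open>t\<close>], \<open>F t\<close> is
  at most every earlier value, hence at most their limit. Applied to a difference of two quantities,
  this replaces integrating a differential inequality from the singular endpoint 0.\<close>

lemma nonpos_of_tendsto_zero:
  fixes F :: "real \<Rightarrow> real"
  assumes "0 < t"
    and deriv: "\<And>s. 0 < s \<Longrightarrow> s \<le> t \<Longrightarrow> \<exists>D. (F has_real_derivative D) (at s) \<and> D \<le> 0"
    and lim: "(F \<longlongrightarrow> 0) (at_right 0)"
  shows "F t \<le> 0"
proof (rule tendsto_lowerbound[OF lim])
  have "F t \<le> F s" if "0 < s" "s < t" for s
    using that by (intro DERIV_nonpos_imp_nonincreasing[of s t F] deriv) auto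
  then show "eventually (\<lambda>s. F t \<le> F s) (at_right 0)"
    using \<open>0 < t\<close> by (auto simp: eventually_at_right_field)
qed simp

text \<open>Abstract form of the system for \<open>v\<close> = u/\<phi> and \<open>W\<close> =
  \<open>Q\<close> v', where the geometry enters only through bounds on the coefficients. The final
  exponent is the one for which t^\<beta> \<open>v\<close> = O(t^(2/(1-p))). The estimate runs on
  v^(1-p), for which the sublinear term becomes a mere inhomogeneity.\<close>

lemma degenerate_system_decay:
  fixes v W Q K k :: "real \<Rightarrow> real"
  assumes p: "0 < p" "p < 1" and \<beta>: "1/2 \<le> \<beta>" "\<beta> < 2 / (1 - p)"
    and h: "0 < h" "h \<le> 1" and q: "0 < q\<^sub>1" and C: "0 \<le> C"
    and dv: "\<And>t. 0 < t \<Longrightarrow> t < h \<Longrightarrow> (v has_real_derivative W t / Q t) (at t)"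
    and dW: "\<And>t. 0 < t \<Longrightarrow> t < h \<Longrightarrow>
      (W has_real_derivative Q t * (k t * v t powr p + K t * v t)) (at t)"
    and pos: "\<And>t. 0 < t \<Longrightarrow> t < h \<Longrightarrow> 0 < v t"
    and Q: "\<And>t. 0 < t \<Longrightarrow> t < h \<Longrightarrow> q\<^sub>1 * t powr (2 * \<beta>) \<le> Q t"
      "\<And>t. 0 < t \<Longrightarrow> t < h \<Longrightarrow> Q t \<le> q\<^sub>2 * t powr (2 * \<beta>)"
    and k: "\<And>t. 0 < t \<Longrightarrow> t < h \<Longrightarrow> 0 \<le> k t"
      "\<And>t. 0 < t \<Longrightarrow> t < h \<Longrightarrow> k t \<le> C * t powr (- (\<beta> * (1 - p)))"
    and K: "\<And>t. 0 < t \<Longrightarrow> t < h \<Longrightarrow> 0 \<le> K t"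
      "\<And>t. 0 < t \<Longrightarrow> t < h \<Longrightarrow> K t \<le> C / t"
    and lim: "(v \<longlongrightarrow> 0) (at_right 0)"
  obtains B where "\<And>t. 0 < t \<Longrightarrow> t < h \<Longrightarrow> v t \<le> B * t powr (2 / (1 - p) - \<beta>)"
proof -
  have Qpos: "0 < Q t" if "0 < t" "t < h" for t
    using Q(1)[OF that] q that by (smt (verit) mult_pos_pos powr_gt_zero)
  have q2: "0 < q\<^sub>2"
    using Q(2)[of "h/2"] Qpos[of "h/2"] h
    by (smt (verit) field_sum_of_halves powr_gt_zero zero_less_mult_pos2)
  have W_mono: "W s \<le> W t" if "0 < s" "s \<le> t" "t < h" for s t
  proof (rule DERIV_nonneg_imp_nondecreasing[of s t W, OF \<open>s \<le> t\<close>])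
    fix x assume x: "s \<le> x" "x \<le> t"
    then have "0 \<le> Q x * (k x * v x powr p + K x * v x)"
      using that Qpos[of x] k(1)[of x] K(1)[of x] pos[of x] by simp
    then show "\<exists>y. (W has_real_derivative y) (at x) \<and> 0 \<le> y"
      using dW[of x] x that by auto
  qed
  \<comment> \<open>If \<open>W t\<close> < 0, monotonicity keeps \<open>W\<close> negative on (0,
    \<open>t\<close>], so \<open>v\<close> is nonincreasing there and its limit at 0 would be at
    least \<open>v t\<close> > 0.\<close>
  have W_nonneg: "0 \<le> W t" if t: "0 < t" "t < h" for t
  proof (rule ccontr)
    assume neg: "\<not> 0 \<le> W t"
    have "v t \<le> v s" if s: "0 < s" "s < t" for s
    proof (rule DERIV_nonpos_imp_nonincreasing[of s t v])
      fix x assume x: "s \<le> x" "x \<le> t"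
      then have "W x / Q x \<le> 0"
        using W_mono[of x t] Qpos[of x] neg s t by (simp add: divide_nonpos_pos)
      then show "\<exists>y. (v has_real_derivative y) (at x) \<and> y \<le> 0"
        using dv[of x] x s t by auto
    qed (use s in auto)
    then have "eventually (\<lambda>s. v t \<le> v s) (at_right 0)"
      using t by (auto simp: eventually_at_right_field)
    from tendsto_lowerbound[OF lim this] show False using pos[OF t] by simp
  qed
  have v_mono: "v s \<le> v t" if "0 < s" "s \<le> t" "t < h" for s t
  proof (rule DERIV_nonneg_imp_nondecreasing[of s t v, OF \<open>s \<le> t\<close>])
    fix x assume x: "s \<le> x" "x \<le> t"
    then have "0 \<le> W x / Q x"
      using that Qpos[of x] W_nonneg[of x] by simp
    then show "\<exists>y. (v has_real_derivative y) (at x) \<and> 0 \<le> y"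
      using dv[of x] x that by auto
  qed
  \<comment> \<open>If \<open>W\<close> stayed above some \<open>c > 0\<close>, then \<open>v'\<close> would dominate a multiple of
    \<open>1 / t\<close> (as \<open>2 * \<beta> \<ge> 1\<close>), and \<open>v\<close> would tend to \<open>-\<infinity>\<close> at 0.\<close>
  have W_small: "\<exists>t. 0 < t \<and> t < h \<and> W t < c" if c: "0 < c" for c
  proof (rule ccontr)
    assume "\<not> ?thesis"
    then have Wc: "c \<le> W t" if "0 < t" "t < h" for t using that by force
    define b where "b = c / q\<^sub>2"
    have b: "0 < b" using c q2 by (simp add: b_def)
    define T where "T = h / 2"
    have T: "0 < T" "T < h" using h by (auto simp: T_def)
    have "v s - b * ln s \<le> v T - b * ln T" if s: "0 < s" "s < T" for s
    proof (rule DERIV_nonneg_imp_nondecreasing[of s T "\<lambda>s. v s - b * ln s"])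
      fix x assume x: "s \<le> x" "x \<le> T"
      then have x': "0 < x" "x < h" using s T by auto
      have "x powr (2 * \<beta>) \<le> x powr 1"
        using x' h \<beta> by (intro powr_mono') auto
      then have "Q x \<le> q\<^sub>2 * x"
        using Q(2)[OF x'] q2 x' by (smt (verit) mult_left_mono powr_one)
      then have "c / (q\<^sub>2 * x) \<le> W x / Q x"
        using Wc[OF x'] c Qpos[OF x'] by (intro frac_le) auto
      then have "0 \<le> W x / Q x - b * (1 / x)" by (simp add: b_def)
      moreover have "((\<lambda>s. v s - b * ln s) has_real_derivative (W x / Q x - b * (1 / x))) (at x)"
        using x' by (auto intro!: derivative_eq_intros dv)
      ultimately show "\<exists>y. ((\<lambda>s. v s - b * ln s) has_real_derivative y) (at x) \<and> 0 \<le> y"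
        by blast
    qed (use s in auto)
    then have low: "0 < v T - b * ln T + b * ln s" if "0 < s" "s < T" for s
      using that pos[of s] T by fastforce
    \<comment> \<open>The exponential is the point at which the lower bound
      \<open>v T - b * ln T + b * ln s\<close> vanishes; the minimum keeps \<open>s\<close> below
      \<open>T\<close>.\<close>
    define s where "s = min (T / 2) (exp ((b * ln T - v T) / b))"
    have s: "0 < s" "s < T" using T by (auto simp: s_def)
    have "ln s \<le> ln (exp ((b * ln T - v T) / b))"
      using s(1) by (subst ln_le_cancel_iff) (auto simp: s_def)
    then have "b * ln s \<le> b * ln T - v T" using b by (simp add: field_simps)
    then show False using low[OF s] by simp
  qed
  have W_lim: "(W \<longlongrightarrow> 0) (at_right 0)"
  proof (rule order_tendstoI)
    fix c :: real assume "c < 0"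
    then show "eventually (\<lambda>t. c < W t) (at_right 0)"
      using h W_nonneg by (force simp: eventually_at_right_field)
  next
    fix c :: real assume "0 < c"
    then obtain t where "0 < t" "t < h" "W t < c" using W_small by blast
    then show "eventually (\<lambda>t. W t < c) (at_right 0)"
      using W_mono[of _ t] by (force simp: eventually_at_right_field)
  qed
  \<comment> \<open>\<open>\<gamma>\<close> is the decay exponent of v^(1-p), positive exactly
    because \<beta> < 2/(1-p). The product \<open>Q s * k s\<close> is at most
    \<open>D * s powr (e - 1)\<close>, so \<open>e\<close> is the exponent after integration, and
    \<open>e\<close> - 2\<beta> = \<open>\<gamma>\<close> - 1.\<close>
  define \<gamma> where "\<gamma> = 2 - \<beta> * (1 - p)"
  have \<gamma>: "0 < \<gamma>" using \<beta> p by (simp add: \<gamma>_def field_simps)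
  define e where "e = \<beta> * (1 + p) + 1"
  have e: "1 \<le> e" using \<beta> p by (simp add: e_def)
  define D where "D = q\<^sub>2 * C"
  have D: "0 \<le> D" using q2 C by (simp add: D_def)
  \<comment> \<open>By monotonicity \<open>v s\<close> is replaced by \<open>v t\<close> for s \<le>
    t; with this value frozen, the bound on W' is a sum of pure powers of s and is integrated from
    0, where \<open>W\<close> vanishes.\<close>
  have W_le: "W t \<le> D * v t powr p * t powr e + D * v t * t powr (2 * \<beta>)"
    if t: "0 < t" "t < h" for t
  proof -
    define F where "F s = W s - (D * v t powr p * (s powr e / e) +
      D * v t * (s powr (2 * \<beta>) / (2 * \<beta>)))" for s
    have "F t \<le> 0"
    proof (rule nonpos_of_tendsto_zero[OF t(1)])
      fix s assume s: "0 < s" "s \<le> t"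
      then have s': "0 < s" "s < h" using t by auto
      have "((\<lambda>s. s powr e / e) has_real_derivative s powr (e - 1)) (at s)"
        using s e by (auto intro!: derivative_eq_intros)
      moreover have "((\<lambda>s. s powr (2 * \<beta>) / (2 * \<beta>)) has_real_derivative s powr (2 * \<beta> - 1)) (at s)"
        using s \<beta> by (auto intro!: derivative_eq_intros)
      ultimately have dF: "(F has_real_derivative
         (Q s * (k s * v s powr p + K s * v s) -
          (D * v t powr p * s powr (e - 1) + D * v t * s powr (2 * \<beta> - 1)))) (at s)"
        unfolding F_def
        by (intro DERIV_diff DERIV_add DERIV_cmult dW s')
      have vs: "v s \<le> v t" "0 < v s" using v_mono s t pos s' by auto
      have kv: "k s * v s powr p \<le> (C * s powr (- (\<beta> * (1 - p)))) * v t powr p"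
        using k[OF s'] vs p by (intro mult_mono powr_mono2) auto
      have Kv: "K s * v s \<le> (C / s) * v t"
        using K[OF s'] vs by (intro mult_mono) auto
      have "Q s * (k s * v s powr p + K s * v s) \<le>
         (q\<^sub>2 * s powr (2 * \<beta>)) * ((C * s powr (- (\<beta> * (1 - p)))) * v t powr p + (C / s) * v t)"
        using Q(2)[OF s'] q2 k(1)[OF s'] K(1)[OF s'] vs
        by (intro mult_mono[OF _ add_mono[OF kv Kv]]) auto
      also have "\<dots> = D * v t powr p * (s powr (2 * \<beta>) * s powr (- (\<beta> * (1 - p))))
          + D * v t * (s powr (2 * \<beta>) / s powr 1)"
        using s' by (simp add: D_def algebra_simps)
      also have "s powr (2 * \<beta>) * s powr (- (\<beta> * (1 - p))) = s powr (e - 1)"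
        by (simp add: powr_add[symmetric] e_def algebra_simps)
      also have "s powr (2 * \<beta>) / s powr 1 = s powr (2 * \<beta> - 1)"
        by (rule powr_diff[symmetric])
      finally show "\<exists>D. (F has_real_derivative D) (at s) \<and> D \<le> 0"
        using dF by (intro exI conjI) auto
    next
      \<comment> \<open>Both powers have value 0 at base 0, so the limit of \<open>F\<close>
        simplifies to 0.\<close>
      have "((\<lambda>s. s powr e / e) \<longlongrightarrow> 0 powr e / e) (at_right 0)"
        using e by (intro tendsto_intros) (auto simp: eventually_at_right_field intro!: exI[of _ 1])
      moreover have "((\<lambda>s. s powr (2*\<beta>) / (2*\<beta>)) \<longlongrightarrow> 0 powr (2*\<beta>) / (2*\<beta>)) (at_right 0)"
        using \<beta> by (intro tendsto_intros) (auto simp: eventually_at_right_field intro!: exI[of _ 1])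
      ultimately have "(F \<longlongrightarrow> 0 - (D * v t powr p * (0 powr e / e) +
          D * v t * (0 powr (2*\<beta>) / (2*\<beta>)))) (at_right 0)"
        unfolding F_def by (intro tendsto_diff tendsto_add tendsto_mult_left W_lim)
      then show "(F \<longlongrightarrow> 0) (at_right 0)" by simp
    qed
    moreover have "x / c \<le> x" if "1 \<le> c" "0 \<le> x" for x c :: real
      using mult_left_mono[of 1 c x] that by (simp add: divide_le_eq)
    then have "t powr e / e \<le> t powr e" "t powr (2 * \<beta>) / (2 * \<beta>) \<le> t powr (2 * \<beta>)"
      using e \<beta> by simp_all
    then have "D * v t powr p * (t powr e / e) + D * v t * (t powr (2 * \<beta>) / (2 * \<beta>)) \<le>
        D * v t powr p * t powr e + D * v t * t powr (2 * \<beta>)"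
      using D pos[OF t] by (intro add_mono mult_left_mono) auto
    ultimately show ?thesis by (simp add: F_def)
  qed
  define E where "E = (1 - p) * (D / q\<^sub>1)"
  have E: "0 \<le> E" using D q p by (simp add: E_def)
  \<comment> \<open>The factor v^(-p) from differentiating v^(1-p) cancels v^p in the bound for
    \<open>W t / Q t\<close>, leaving a linear inequality for v^(1-p).\<close>
  have y_deriv: "\<exists>y'. ((\<lambda>t. v t powr (1 - p)) has_real_derivative y') (at t) \<and>
      y' \<le> E * (t powr (\<gamma> - 1) + v t powr (1 - p))" if t: "0 < t" "t < h" for t
  proof -
    have "W t / Q t \<le> (D * v t powr p * t powr e + D * v t * t powr (2 * \<beta>)) / (q\<^sub>1 * t powr (2 * \<beta>))"
      using W_le[OF t] W_nonneg[OF t] Q(1)[OF t] Qpos[OF t] q t by (intro frac_le) auto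
    also have "\<dots> = (D / q\<^sub>1) * (v t powr p * (t powr e / t powr (2 * \<beta>)) + v t)"
      using q t by (simp add: field_simps)
    also have "t powr e / t powr (2 * \<beta>) = t powr (\<gamma> - 1)"
      by (simp add: powr_diff[symmetric] e_def \<gamma>_def algebra_simps)
    finally have "(1 - p) * v t powr (- p) * (W t / Q t) \<le>
        (1 - p) * v t powr (- p) * ((D / q\<^sub>1) * (v t powr p * t powr (\<gamma> - 1) + v t))"
      using p by (intro mult_left_mono) auto
    also have "\<dots> = E * ((v t powr (- p) * v t powr p) * t powr (\<gamma> - 1) + v t powr (- p) * v t powr 1)"
      using pos[OF t] by (simp add: E_def algebra_simps diff_divide_distrib)
    also have "v t powr (- p) * v t powr p = 1"
      using pos[OF t] by (simp add: powr_add[symmetric])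
    also have "v t powr (- p) * v t powr 1 = v t powr (1 - p)"
      using powr_add[of "v t" "- p" 1] by simp
    finally have "(1 - p) * v t powr (- p) * (W t / Q t) \<le> E * (t powr (\<gamma> - 1) + v t powr (1 - p))"
      by simp
    moreover have "((\<lambda>t. v t powr (1 - p)) has_real_derivative
        (1 - p) * v t powr (- p) * (W t / Q t)) (at t)"
      using pos[OF t] by (auto intro!: derivative_eq_intros dv t)
    ultimately show ?thesis by blast
  qed
  have y_le: "v t powr (1 - p) \<le> exp E * (E / \<gamma>) * t powr \<gamma>" if t: "0 < t" "t < h" for t
  proof -
    define F where "F s = exp (- E * s) * v s powr (1 - p) - E * (s powr \<gamma> / \<gamma>)" for s
    have "F t \<le> 0"
    proof (rule nonpos_of_tendsto_zero[OF t(1)])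
      fix s assume s: "0 < s" "s \<le> t"
      then have s': "0 < s" "s < h" using t by auto
      obtain y' where y': "((\<lambda>t. v t powr (1 - p)) has_real_derivative y') (at s)"
        "y' \<le> E * (s powr (\<gamma> - 1) + v s powr (1 - p))" using y_deriv[OF s'] by blast
      have ds: "((\<lambda>s. s powr \<gamma> / \<gamma>) has_real_derivative s powr (\<gamma> - 1)) (at s)"
        using s \<gamma> by (auto intro!: derivative_eq_intros)
      have de: "((\<lambda>s. exp (- E * s)) has_real_derivative - E * exp (- E * s)) (at s)"
        by (auto intro!: derivative_eq_intros)
      have dF: "(F has_real_derivative
         (- E * exp (- E * s)) * v s powr (1 - p) + y' * exp (- E * s) - E * s powr (\<gamma> - 1)) (at s)"
        unfolding F_def by (intro DERIV_diff DERIV_mult DERIV_cmult de ds y')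
      have "y' * exp (- E * s) \<le> E * (s powr (\<gamma> - 1) + v s powr (1 - p)) * exp (- E * s)"
        using y' by (intro mult_right_mono) auto
      moreover have "E * s powr (\<gamma> - 1) * exp (- E * s) \<le> E * s powr (\<gamma> - 1) * 1"
        using E s by (intro mult_left_mono) auto
      ultimately have "(- E * exp (- E * s)) * v s powr (1 - p) + y' * exp (- E * s) - E * s powr (\<gamma> - 1) \<le> 0"
        by (simp add: algebra_simps)
      then show "\<exists>D. (F has_real_derivative D) (at s) \<and> D \<le> 0"
        using dF by blast
    next
      \<comment> \<open>Passing to the limit in a real power at base 0 requires an eventually
        nonnegative base and a positive exponent.\<close>
      have "eventually (\<lambda>s. 0 \<le> v s) (at_right 0)"
        using h pos by (force simp: eventually_at_right_field)
      then have "((\<lambda>s. v s powr (1 - p)) \<longlongrightarrow> 0 powr (1 - p)) (at_right 0)"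
        using p by (intro tendsto_powr' lim tendsto_intros) auto
      moreover have "((\<lambda>s. s powr \<gamma> / \<gamma>) \<longlongrightarrow> 0 powr \<gamma> / \<gamma>) (at_right 0)"
        using \<gamma> by (intro tendsto_intros) (auto simp: eventually_at_right_field intro!: exI[of _ 1])
      moreover have "((\<lambda>s. exp (- E * s)) \<longlongrightarrow> exp (- E * 0)) (at_right 0)"
        by (intro tendsto_intros)
      ultimately have "(F \<longlongrightarrow> exp (- E * 0) * 0 powr (1 - p) - E * (0 powr \<gamma> / \<gamma>)) (at_right 0)"
        unfolding F_def by (intro tendsto_diff tendsto_mult tendsto_const)
      then show "(F \<longlongrightarrow> 0) (at_right 0)" by simp
    qed
    then have "exp (- E * t) * v t powr (1 - p) \<le> (E / \<gamma>) * t powr \<gamma>"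
      by (simp add: F_def)
    then have "exp (E * t) * (exp (- E * t) * v t powr (1 - p)) \<le> exp (E * t) * ((E / \<gamma>) * t powr \<gamma>)"
      by (intro mult_left_mono) auto
    then have "v t powr (1 - p) \<le> exp (E * t) * ((E / \<gamma>) * t powr \<gamma>)"
      by (simp add: mult.assoc[symmetric] exp_add[symmetric])
    also have "\<dots> \<le> exp E * ((E / \<gamma>) * t powr \<gamma>)"
      using t h E \<gamma> by (intro mult_right_mono) (auto simp: mult_left_le)
    finally show ?thesis by (simp add: mult.assoc)
  qed
  show thesis
  proof
    fix t assume t: "0 < t" "t < h"
    have "v t = (v t powr (1 - p)) powr (1 / (1 - p))"
      using pos[OF t] p by (simp add: powr_powr)
    also have "\<dots> \<le> (exp E * (E / \<gamma>) * t powr \<gamma>) powr (1 / (1 - p))"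
      using y_le[OF t] p by (intro powr_mono2) auto
    also have "\<dots> = (exp E * (E / \<gamma>)) powr (1 / (1 - p)) * t powr (\<gamma> / (1 - p))"
      using E \<gamma> by (subst powr_mult) (simp_all add: powr_powr)
    also have "\<gamma> / (1 - p) = 2 / (1 - p) - \<beta>"
      using p by (simp add: \<gamma>_def field_simps)
    finally show "v t \<le> (exp E * (E / \<gamma>)) powr (1 / (1 - p)) * t powr (2 / (1 - p) - \<beta>)" .
  qed
qed

section \<open>The critical exponent and the threshold for \<mu>\<close>

text \<open>The indicial equation: t^\<beta> solves u'' + \<mu> u / t^2 = 0 exactly for its roots,
  and \<open>beta_plus \<mu>\<close> is the larger one.\<close>

lemma beta_plus_root:
  assumes "\<mu> \<le> 1/4"
  shows "beta_plus \<mu> * (beta_plus \<mu> - 1) = - \<mu>" and "1/2 \<le> beta_plus \<mu>"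
proof -
  have "(sqrt (1/4 - \<mu>))\<^sup>2 = 1/4 - \<mu>" using assms by simp
  then show "beta_plus \<mu> * (beta_plus \<mu> - 1) = - \<mu>"
    by (simp add: beta_plus_def power2_eq_square algebra_simps)
  show "1/2 \<le> beta_plus \<mu>" using assms by (simp add: beta_plus_def)
qed

text \<open>The right side compares sqrt(1/4 - \<mu>) with \<open>c\<close> = 2/(1-p) - 1/2. As
  \<open>c\<close> is nonnegative, squaring loses nothing, and c^2 equals 1/4 +
  \<open>mu_star p\<close>.\<close>

lemma mu_star_less_iff:
  assumes "0 < p" "p < 1" "\<mu> \<le> 1/4"
  shows "- mu_star p < \<mu> \<longleftrightarrow> beta_plus \<mu> < 2 / (1 - p)"
proof -
  define c where "c = 2 / (1 - p) - 1 / 2"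
  have c: "0 \<le> c" using assms by (simp add: c_def field_simps)
  have "beta_plus \<mu> < 2 / (1 - p) \<longleftrightarrow> sqrt (1/4 - \<mu>) < sqrt (c\<^sup>2)"
    using c by (auto simp: beta_plus_def c_def)
  also have "\<dots> \<longleftrightarrow> 1/4 - \<mu> < c\<^sup>2" by (rule real_sqrt_less_iff)
  also have "c\<^sup>2 = 1/4 + mu_star p"
  proof -
    define q where "q = 1 - p"
    have p: "p = 1 - q" and "q \<noteq> 0" using assms by (auto simp: q_def)
    then show ?thesis
      unfolding c_def mu_star_def p by (simp add: field_simps power2_eq_square)
  qed
  finally show ?thesis by auto
qed

section \<open>The one-dimensional equation with a weight\<close>

text \<open>\<open>P\<close> stands for r^(N-1) as a function of the boundary distance: bounded
  above, bounded away from 0, with logarithmic derivative at most \<open>A\<close> in absolute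
  value. Dividing u by a suitable \<phi> brings the equation into the form of
  \<open>degenerate_system_decay\<close>.\<close>

lemma no_intermediate_decay:
  fixes u u\<^sub>1 u\<^sub>2 P P\<^sub>1 :: "real \<Rightarrow> real"
  assumes p: "0 < p" "p < 1" and \<mu>: "\<mu> \<le> 1/4" "beta_plus \<mu> < 2 / (1 - p)"
    and h: "0 < h"
    and du: "\<And>t. 0 < t \<Longrightarrow> t < h \<Longrightarrow> (u has_real_derivative u\<^sub>1 t) (at t)"
    and du1: "\<And>t. 0 < t \<Longrightarrow> t < h \<Longrightarrow> (u\<^sub>1 has_real_derivative u\<^sub>2 t) (at t)"
    and dP: "\<And>t. 0 < t \<Longrightarrow> t < h \<Longrightarrow> (P has_real_derivative P\<^sub>1 t) (at t)"
    and pos: "\<And>t. 0 < t \<Longrightarrow> t < h \<Longrightarrow> 0 < u t"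
    and P: "\<And>t. 0 < t \<Longrightarrow> t < h \<Longrightarrow> m \<le> P t" "\<And>t. 0 < t \<Longrightarrow> t < h \<Longrightarrow> P t \<le> M"
      "\<And>t. 0 < t \<Longrightarrow> t < h \<Longrightarrow> \<bar>P\<^sub>1 t\<bar> \<le> A * P t"
    and m: "0 < m" and A: "0 < A"
    and ode: "\<And>t. 0 < t \<Longrightarrow> t < h \<Longrightarrow>
      u\<^sub>2 t + P\<^sub>1 t / P t * u\<^sub>1 t + \<mu> / t\<^sup>2 * u t = u t powr p"
  shows "\<not> intermediate_decay \<mu> p u"
proof
  assume decay: "intermediate_decay \<mu> p u"
  define \<beta> where "\<beta> = beta_plus \<mu>"
  have \<beta>: "1/2 \<le> \<beta>" "\<beta> < 2 / (1 - p)" and root: "\<mu> = \<beta> - \<beta>\<^sup>2"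
    using beta_plus_root[OF \<mu>(1)] \<mu>(2) by (auto simp: \<beta>_def power2_eq_square algebra_simps)
  \<comment> \<open>The factor \<open>exp (- A t)\<close> makes \<open>\<phi>\<close> a supersolution of the linear equation
    near 0, whatever the sign of the first-order coefficient.\<close>
  define \<phi> where "\<phi> t = t powr \<beta> * exp (- A * t)" for t
  \<comment> \<open>\<open>\<psi>\<close> is \<phi>'/\<phi>, and \<open>W\<close> is P \<phi>^2 v'
    expressed through u. \<open>K\<close> equals -(\<phi>'' + a \<phi>' + \<mu> \<phi> /
    t^2)/\<phi>, so the supersolution property is \<open>K\<close> \<ge> 0.\<close>
  define \<psi> where "\<psi> t = \<beta> / t - A" for t
  define a where "a t = P\<^sub>1 t / P t" for t
  define K where "K t = (2 * A - a t) * \<beta> / t - A * (A - a t)" for t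
  define v where "v t = u t / \<phi> t" for t
  define W where "W t = P t * \<phi> t * (u\<^sub>1 t - \<psi> t * u t)" for t
  define Q where "Q t = P t * (\<phi> t)\<^sup>2" for t
  define k where "k t = \<phi> t powr (p - 1)" for t
  \<comment> \<open>The bound \<beta>/(2A) secures \<open>K\<close> \<ge> 0; the bound 1 keeps
    \<open>exp (- A * t)\<close> between \<open>exp (- A)\<close> and 1.\<close>
  define h' where "h' = Min {h, 1, \<beta> / (2 * A)}"
  have h': "0 < h'" "h' \<le> h" "h' \<le> 1" "h' \<le> \<beta> / (2 * A)"
    using h A \<beta> by (auto simp: h'_def)
  have phi_pos: "0 < \<phi> t" if "0 < t" for t using that by (simp add: \<phi>_def)
  have dphi: "(\<phi> has_real_derivative \<psi> t * \<phi> t) (at t)" if "0 < t" for t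
  proof -
    have "t powr (\<beta> - 1) = t powr \<beta> / t" using that by (simp add: powr_diff)
    then show ?thesis unfolding \<phi>_def \<psi>_def using that
      by (auto intro!: derivative_eq_intros simp: algebra_simps)
  qed
  have dpsi: "(\<psi> has_real_derivative - \<beta> / t\<^sup>2) (at t)" if "0 < t" for t
    unfolding \<psi>_def using that
    by (auto intro!: derivative_eq_intros simp: power2_eq_square)
  have Ppos: "0 < P t" if "0 < t" "t < h" for t using P(1)[OF that] m by simp
  have a: "\<bar>a t\<bar> \<le> A" if "0 < t" "t < h" for t
    using P(3)[OF that] Ppos[OF that] by (simp add: a_def divide_le_eq)
  have exp_ge: "exp (- A) \<le> exp (- A * t)" "exp (- A * t) \<le> 1" if "0 < t" "t < h'" for t
    using that h' A by (auto simp: mult_left_le)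
  have sq: "(t powr \<beta>)\<^sup>2 = t powr (2 * \<beta>)" for t :: real
    by (simp add: power2_eq_square powr_add[symmetric])
  \<comment> \<open>\<open>C\<close> has to serve for both coefficients: its first entry bounds the
    exponential factor of \<open>k\<close>, its second comes from 2A - a \<le> 3A in
    \<open>K\<close>.\<close>
  obtain B where B: "\<And>t. 0 < t \<Longrightarrow> t < h' \<Longrightarrow> v t \<le> B * t powr (2 / (1 - p) - \<beta>)"
  proof (rule degenerate_system_decay[OF p \<beta> h'(1,3), where v = v and W = W and Q = Q
        and k = k and K = K and q\<^sub>1 = "m * (exp (- A))\<^sup>2" and q\<^sub>2 = M
        and C = "max (exp (- A) powr (p - 1)) (3 * A * \<beta>)"])
    show "0 < m * (exp (- A))\<^sup>2" using m by simp
    show "0 \<le> max (exp (- A) powr (p - 1)) (3 * A * \<beta>)" by (simp add: le_max_iff_disj)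
    fix t assume t': "0 < t" "t < h'"
    then have t: "0 < t" "t < h" using h' by auto
    note pos' = pos[OF t] phi_pos[OF t(1)] Ppos[OF t]
    show "(v has_real_derivative W t / Q t) (at t)"
    proof -
      have "(v has_real_derivative (u\<^sub>1 t * \<phi> t - u t * (\<psi> t * \<phi> t)) / (\<phi> t * \<phi> t)) (at t)"
        unfolding v_def using pos' by (intro DERIV_divide du dphi t) auto
      moreover have "(u\<^sub>1 t * \<phi> t - u t * (\<psi> t * \<phi> t)) / (\<phi> t * \<phi> t) = W t / Q t"
        using pos' by (simp add: W_def Q_def field_simps power2_eq_square)
      ultimately show ?thesis by simp
    qed
    show "(W has_real_derivative Q t * (k t * v t powr p + K t * v t)) (at t)"
    proof -
      have P1: "P\<^sub>1 t = a t * P t" using pos' by (simp add: a_def)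
      have "(W has_real_derivative
        (P\<^sub>1 t * \<phi> t + \<psi> t * \<phi> t * P t) * (u\<^sub>1 t - \<psi> t * u t) +
        (u\<^sub>2 t - ((- \<beta> / t\<^sup>2) * u t + u\<^sub>1 t * \<psi> t)) * (P t * \<phi> t)) (at t)"
        unfolding W_def by (intro DERIV_mult DERIV_diff dP dphi du du1 dpsi t)
      moreover have u2: "u\<^sub>2 t = u t powr p - a t * u\<^sub>1 t - \<mu> / t\<^sup>2 * u t"
        using ode[OF t] by (simp add: a_def)
      \<comment> \<open>The indicial equation cancels all terms in t^(-2), so \<open>K\<close> is
        only of order 1/t.\<close>
      have psi2: "\<beta> / t\<^sup>2 - \<mu> / t\<^sup>2 - \<psi> t * \<psi> t - a t * \<psi> t = K t"
        using t by (simp add: root \<psi>_def K_def field_simps power2_eq_square)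
      have "Q t * (k t * v t powr p + K t * v t) =
          P t * \<phi> t * (u t powr p + K t * u t)"
      proof -
        have "\<phi> t powr (p - 1) * (u t / \<phi> t) powr p = u t powr p / \<phi> t"
          using pos' by (simp add: powr_divide powr_diff)
        then show ?thesis
          using pos' by (simp add: Q_def k_def v_def field_simps power2_eq_square)
      qed
      moreover have "(P\<^sub>1 t * \<phi> t + \<psi> t * \<phi> t * P t) * (u\<^sub>1 t - \<psi> t * u t) +
        (u\<^sub>2 t - ((- \<beta> / t\<^sup>2) * u t + u\<^sub>1 t * \<psi> t)) * (P t * \<phi> t) =
        P t * \<phi> t * (u t powr p + K t * u t)"
        unfolding P1 u2 psi2[symmetric] by (simp add: algebra_simps)
      ultimately show ?thesis by simp
    qed
    show "0 < v t" using pos' by (simp add: v_def)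
    show "m * (exp (- A))\<^sup>2 * t powr (2 * \<beta>) \<le> Q t"
    proof -
      have "m * (t powr (2 * \<beta>) * (exp (- A))\<^sup>2) \<le> P t * (t powr (2 * \<beta>) * (exp (- A * t))\<^sup>2)"
        using P(1)[OF t] m exp_ge[OF t'] by (intro mult_mono power_mono) auto
      then show ?thesis by (simp add: Q_def \<phi>_def power_mult_distrib sq mult.commute mult.left_commute)
    qed
    show "Q t \<le> M * t powr (2 * \<beta>)"
    proof -
      have "P t * (t powr (2 * \<beta>) * (exp (- A * t))\<^sup>2) \<le> M * (t powr (2 * \<beta>) * 1\<^sup>2)"
        using P(2)[OF t] pos' exp_ge[OF t'] by (intro mult_mono power_mono) auto
      then show ?thesis by (simp add: Q_def \<phi>_def power_mult_distrib sq)
    qed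
    show "0 \<le> k t" by (simp add: k_def)
    show "k t \<le> max (exp (- A) powr (p - 1)) (3 * A * \<beta>) * t powr (- (\<beta> * (1 - p)))"
    proof -
      have "k t = exp (- A * t) powr (p - 1) * t powr (- (\<beta> * (1 - p)))"
        using t by (simp add: k_def \<phi>_def powr_mult powr_powr algebra_simps)
      also have "exp (- A * t) powr (p - 1) \<le> exp (- A) powr (p - 1)"
        using exp_ge[OF t'] p by (intro powr_mono2') auto
      finally show ?thesis by (smt (verit) mult_right_mono powr_ge_zero)
    qed
    have Kt: "K t * t = (2 * A - a t) * \<beta> - A * (A - a t) * t"
      using t by (simp add: K_def field_simps)
    have "t \<le> \<beta> / (2 * A)" using t' h' by linarith
    then have tA: "2 * A * t \<le> \<beta>" using A by (simp add: field_simps)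
    \<comment> \<open>In \<open>K t * t\<close> the leading term is at least A \<beta>, while the
      subtracted one is at most 2 A^2 t, hence at most A \<beta> by \<open>tA\<close>.\<close>
    have at: "A \<le> 2 * A - a t" "2 * A - a t \<le> 3 * A" "0 \<le> A - a t" "A - a t \<le> 2 * A"
      using a[OF t] by auto
    show "0 \<le> K t"
    proof -
      have "(A * t) * (A - a t) \<le> (A * t) * (2 * A)"
        using at t A by (intro mult_left_mono) auto
      also have "\<dots> \<le> A * \<beta>" using tA A by (simp add: mult.commute mult.left_commute)
      also have "\<dots> \<le> (2 * A - a t) * \<beta>"
        using at \<beta> by (intro mult_right_mono) auto
      finally have "0 \<le> K t * t" unfolding Kt by (simp add: algebra_simps)
      then show ?thesis using t by (simp add: zero_le_mult_iff)
    qed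
    show "K t \<le> max (exp (- A) powr (p - 1)) (3 * A * \<beta>) / t"
    proof -
      have "(2 * A - a t) * \<beta> \<le> 3 * A * \<beta>"
        using at \<beta> by (intro mult_right_mono) auto
      moreover have "0 \<le> A * (A - a t) * t" using at t A by simp
      ultimately have "K t * t \<le> 3 * A * \<beta>" by (simp add: Kt)
      then show ?thesis using t by (simp add: le_divide_eq)
    qed
  next
    have "((\<lambda>t. u t * t powr (- \<beta>) * exp (A * t)) \<longlongrightarrow> 0 * exp (A * 0)) (at_right 0)"
      using decay by (intro tendsto_intros) (simp_all add: intermediate_decay_def \<beta>_def)
    moreover have "u t * t powr (- \<beta>) * exp (A * t) = v t" for t
      by (simp add: v_def \<phi>_def powr_minus exp_minus field_simps)
    ultimately show "(v \<longlongrightarrow> 0) (at_right 0)" by simp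
  qed (use that in blast)
  \<comment> \<open>Multiplying the bound on v by t^\<beta> gives u \<le> B t^(2/(1-p)), so the
    quantity required to diverge stays bounded.\<close>
  have bound: "u t * t powr (2 / (p - 1)) \<le> B" if t: "0 < t" "t < h'" for t
  proof -
    have e: "2 / (p - 1) = - (2 / (1 - p))" using p by (simp add: field_simps)
    have "u t = v t * (t powr \<beta> * exp (- A * t))"
      using t by (simp add: v_def \<phi>_def)
    also have "\<dots> \<le> v t * (t powr \<beta> * 1)"
      using exp_ge[OF t] pos[of t] phi_pos[OF t(1)] t h'
      by (intro mult_left_mono) (auto simp: v_def)
    also have "\<dots> \<le> B * t powr (2 / (1 - p) - \<beta>) * (t powr \<beta> * 1)"
      using B[OF t] by (intro mult_right_mono) auto
    also have "\<dots> = B * t powr (2 / (1 - p))"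
      by (simp add: mult.assoc powr_add[symmetric])
    finally show ?thesis using t by (simp add: e powr_minus field_simps)
  qed
  have "eventually (\<lambda>t. B + 1 \<le> u t * t powr (2 / (p - 1))) (at_right 0)"
    using decay unfolding intermediate_decay_def filterlim_at_top by blast
  moreover have "eventually (\<lambda>t. u t * t powr (2 / (p - 1)) \<le> B) (at_right 0)"
    using bound h'(1) by (auto simp: eventually_at_right_field)
  ultimately have "eventually (\<lambda>t::real. False) (at_right 0)"
    by eventually_elim auto
  then show False by simp
qed

section \<open>Radial functions and the Laplacian\<close>

lemma norm_line_has_derivative:
  fixes x b :: "'a::euclidean_space"
  assumes "x \<noteq> 0"
  shows "((\<lambda>t. norm (x + t *\<^sub>R b)) has_real_derivative (x \<bullet> b) / norm x) (at 0)"
proof -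
  have "(norm has_derivative (\<lambda>h. sgn x \<bullet> h)) (at (x + 0 *\<^sub>R b))"
    using has_derivative_norm[OF assms] by (simp add: inner_commute)
  moreover have "((\<lambda>t::real. x + t *\<^sub>R b) has_derivative (\<lambda>t. t *\<^sub>R b)) (at 0)"
    by (auto intro!: derivative_eq_intros)
  ultimately have "((\<lambda>t. norm (x + t *\<^sub>R b)) has_derivative (\<lambda>t. sgn x \<bullet> (t *\<^sub>R b))) (at 0)"
    by (rule has_derivative_compose[rotated])
  then show ?thesis
    unfolding has_field_derivative_def
    by (rule has_derivative_eq_rhs) (auto simp: sgn_div_norm divide_inverse)
qed

lemma partial_deriv_radial:
  fixes x b :: "'a::euclidean_space"
  assumes "x \<noteq> 0" and g: "(g has_real_derivative D) (at (norm x))"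
  shows "partial_deriv b (\<lambda>x. g (norm x)) x = D * ((x \<bullet> b) / norm x)"
proof -
  have "(g has_real_derivative D) (at (norm (x + 0 *\<^sub>R b)))" using g by simp
  from DERIV_chain2[OF this norm_line_has_derivative[OF assms(1)]] show ?thesis
    unfolding partial_deriv_def by (rule DERIV_imp_deriv)
qed

text \<open>\<open>deriv\<close> is informative only at points of differentiability.
  Differentiability of a restriction to a line is transferred here to the profile \<open>g\<close>,
  so that \<open>deriv g r\<close> is a genuine derivative.\<close>

lemma differentiable_shift:
  fixes F g :: "real \<Rightarrow> real"
  assumes "F differentiable (at 0)" and ev: "eventually (\<lambda>t. F t = g (r + t)) (nhds 0)"
  shows "(g has_real_derivative deriv g r) (at r)" and "deriv F 0 = deriv g r"
proof -
  obtain D where D: "(F has_real_derivative D) (at 0)"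
    using assms(1) by (auto simp: real_differentiable_def)
  then have "((\<lambda>t. g (t + r)) has_real_derivative D) (at 0)"
    using DERIV_cong_ev[OF refl ev refl] by (simp add: add.commute)
  then have g: "(g has_real_derivative D) (at r)"
    using DERIV_shift[of g D 0 r] by simp
  show "(g has_real_derivative deriv g r) (at r)" "deriv F 0 = deriv g r"
    using g DERIV_imp_deriv[OF g] DERIV_imp_deriv[OF D] by simp_all
qed

text \<open>It suffices to evaluate on a coordinate axis. Along \<open>b\<^sub>0\<close> the
  function is g itself, giving g''; each of the N - 1 orthogonal directions contributes
  g'/r.\<close>

lemma radial_laplacian:
  fixes g :: "real \<Rightarrow> real" and S :: "'a::euclidean_space set" and b\<^sub>0 :: 'a
  defines "f \<equiv> \<lambda>x::'a. g (norm x)"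
  assumes C2: "C2_on f S" and lo: "0 \<le> lo"
    and S: "\<And>x. lo < norm x \<Longrightarrow> norm x < hi \<Longrightarrow> x \<in> S"
    and b0: "b\<^sub>0 \<in> Basis" and r: "lo < r" "r < hi"
  shows "(g has_real_derivative deriv g r) (at r)"
    and "(deriv g has_real_derivative deriv (deriv g) r) (at r)"
    and "laplacian f (r *\<^sub>R b\<^sub>0) = deriv (deriv g) r + (real DIM('a) - 1) / r * deriv g r"
proof -
  have norm_b0: "norm (s *\<^sub>R b\<^sub>0) = s" if "0 < s" for s using that b0 by simp
  have diff1: "(\<lambda>t. f (x + t *\<^sub>R b)) differentiable (at 0)" if "x \<in> S" "b \<in> Basis" for x b
    using C2 that by (simp add: C2_on_def C1_on_def)
  have diff2: "(\<lambda>t. partial_deriv b\<^sub>0 f (x + t *\<^sub>R b\<^sub>0)) differentiable (at 0)" if "x \<in> S" for x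
    using C2 that b0 by (simp add: C2_on_def C1_on_def)
  have near: "eventually (\<lambda>t::real. lo < s + t \<and> s + t < hi) (nhds 0)" if "lo < s" "s < hi" for s
    using that eventually_nhds_in_open[of "{lo - s<..<hi - s}" 0]
    by (auto elim!: eventually_mono)
  have g1: "(g has_real_derivative deriv g s) (at s)" if s: "lo < s" "s < hi" for s
  proof (rule differentiable_shift)
    have "s *\<^sub>R b\<^sub>0 \<in> S" using S[of "s *\<^sub>R b\<^sub>0"] s lo b0 by simp
    then show "(\<lambda>t. f (s *\<^sub>R b\<^sub>0 + t *\<^sub>R b\<^sub>0)) differentiable (at 0)" using diff1 b0 by blast
    show "eventually (\<lambda>t. f (s *\<^sub>R b\<^sub>0 + t *\<^sub>R b\<^sub>0) = g (s + t)) (nhds 0)"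
      using near[OF s] by eventually_elim (use lo b0 in \<open>simp add: f_def scaleR_left_distrib[symmetric]\<close>)
  qed
  show "(g has_real_derivative deriv g r) (at r)" using g1 r .
  have pd: "partial_deriv b f x = deriv g (norm x) * ((x \<bullet> b) / norm x)"
    if "lo < norm x" "norm x < hi" for x b
    unfolding f_def using that lo by (intro partial_deriv_radial g1) auto
  have x: "r *\<^sub>R b\<^sub>0 \<in> S" using S[of "r *\<^sub>R b\<^sub>0"] r lo b0 by simp
  have ev: "eventually (\<lambda>t. partial_deriv b\<^sub>0 f (r *\<^sub>R b\<^sub>0 + t *\<^sub>R b\<^sub>0) = deriv g (r + t)) (nhds 0)"
    using near[OF r]
  proof eventually_elim
    case (elim t)
    have "norm ((r + t) *\<^sub>R b\<^sub>0) = r + t" using elim lo norm_b0[of "r + t"] by linarith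
    then show ?case using pd[of "(r + t) *\<^sub>R b\<^sub>0" b\<^sub>0] elim lo b0
      by (simp add: scaleR_left_distrib[symmetric])
  qed
  note shift = differentiable_shift[OF diff2[OF x] ev]
  show g2: "(deriv g has_real_derivative deriv (deriv g) r) (at r)" by (rule shift(1))
  have main: "partial_deriv b\<^sub>0 (partial_deriv b\<^sub>0 f) (r *\<^sub>R b\<^sub>0) = deriv (deriv g) r"
    using shift(2) by (simp add: partial_deriv_def)
  have other: "partial_deriv b (partial_deriv b f) (r *\<^sub>R b\<^sub>0) = deriv g r / r"
    if b: "b \<in> Basis" "b \<noteq> b\<^sub>0" for b
  proof -
    have orth: "b\<^sub>0 \<bullet> b = 0" using b b0 by (simp add: inner_not_same_Basis)
    have r0: "0 < r" using r lo by simp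
    define \<nu> where "\<nu> t = norm (r *\<^sub>R b\<^sub>0 + t *\<^sub>R b)" for t
    have \<nu>0: "\<nu> 0 = r" using r0 b0 by (simp add: \<nu>_def)
    have d\<nu>: "(\<nu> has_real_derivative 0) (at 0)"
      using norm_line_has_derivative[of "r *\<^sub>R b\<^sub>0" b] r0 b0 orth
      unfolding \<nu>_def by (auto simp: nonzero_Basis)
    have "(\<nu> \<longlongrightarrow> \<nu> 0) (nhds 0)"
      using DERIV_isCont[OF d\<nu>] by (simp add: isCont_def tendsto_at_iff_tendsto_nhds)
    then have "eventually (\<lambda>t. \<nu> t \<in> {lo<..<hi}) (nhds 0)"
      using r \<nu>0 by (intro topological_tendstoD) auto
    then have ev: "eventually (\<lambda>t. partial_deriv b f (r *\<^sub>R b\<^sub>0 + t *\<^sub>R b) =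
        deriv g (\<nu> t) * (t / \<nu> t)) (nhds 0)"
    proof eventually_elim
      case (elim t)
      then show ?case using pd[of "r *\<^sub>R b\<^sub>0 + t *\<^sub>R b" b] b orth
        by (simp add: \<nu>_def inner_add_left)
    qed
    \<comment> \<open>At t = 0 the factor \<open>t / \<nu> t\<close> vanishes, so in the product
      rule only \<open>deriv g r\<close> times its derivative 1/r survives.\<close>
    have "(deriv g has_real_derivative deriv (deriv g) r) (at (\<nu> 0))" using g2 \<nu>0 by simp
    from DERIV_chain2[OF this d\<nu>]
    have "((\<lambda>t. deriv g (\<nu> t) * (t / \<nu> t)) has_real_derivative deriv g r / r) (at 0)"
      using r0 \<nu>0 by (auto intro!: derivative_eq_intros d\<nu> simp: field_simps)
    then have "((\<lambda>t. partial_deriv b f (r *\<^sub>R b\<^sub>0 + t *\<^sub>R b)) has_real_derivative deriv g r / r) (at 0)"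
      using DERIV_cong_ev[OF refl ev refl] by simp
    then show ?thesis by (simp add: partial_deriv_def DERIV_imp_deriv)
  qed
  have "laplacian f (r *\<^sub>R b\<^sub>0) = deriv (deriv g) r + (\<Sum>b\<in>Basis - {b\<^sub>0}. deriv g r / r)"
    unfolding laplacian_def using b0 main other by (subst sum.remove[OF _ b0]) auto
  also have "(\<Sum>b\<in>Basis - {b\<^sub>0}. deriv g r / r) = (real DIM('a) - 1) / r * deriv g r"
    using b0 by (simp add: card_Diff_singleton of_nat_diff Suc_le_eq)
  finally show "laplacian f (r *\<^sub>R b\<^sub>0) = deriv (deriv g) r + (real DIM('a) - 1) / r * deriv g r" .
qed

section \<open>Passage from the radial equation to the distance variable\<close>

text \<open>The sign \<sigma> treats both sides of a sphere of radius \<rho> at once, through r =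
  \<rho> + \<sigma> t. It enters u' and P' once each, and \<sigma>^2 = 1 removes it from the
  equation.\<close>

lemma no_radial_intermediate_decay:
  fixes \<Omega> :: "'a::euclidean_space set"
  assumes p: "0 < p" "p < 1" and \<mu>: "\<mu> \<le> 1/4" "beta_plus \<mu> < 2 / (1 - p)"
    and \<sigma>: "\<sigma> = 1 \<or> \<sigma> = -1" and \<rho>: "0 < \<rho>" and h0: "0 < h\<^sub>0"
    and \<Omega>: "\<And>x. 0 < \<sigma> * (norm x - \<rho>) \<Longrightarrow> \<sigma> * (norm x - \<rho>) < h\<^sub>0 \<Longrightarrow> x \<in> \<Omega>"
    and sol: "positive_radial_solution_near \<Omega> (\<lambda>x. \<sigma> * (norm x - \<rho>)) \<mu> p u"
  shows "\<not> intermediate_decay \<mu> p u"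
proof -
  define \<delta> :: "'a \<Rightarrow> real" where "\<delta> x = \<sigma> * (norm x - \<rho>)" for x
  define g where "g r = u (\<sigma> * (r - \<rho>))" for r
  obtain \<delta>\<^sub>0 where d0: "0 < \<delta>\<^sub>0"
    and C2: "C2_on (\<lambda>x::'a. g (norm x)) {x\<in>\<Omega>. \<delta> x < \<delta>\<^sub>0}"
    and eq: "\<And>x. x \<in> \<Omega> \<Longrightarrow> \<delta> x < \<delta>\<^sub>0 \<Longrightarrow> 0 < g (norm x) \<and>
      laplacian (\<lambda>x. g (norm x)) x + \<mu> / (\<delta> x)\<^sup>2 * g (norm x) = g (norm x) powr p"
    using sol unfolding positive_radial_solution_near_def Let_def g_def \<delta>_def by auto
  \<comment> \<open>The bound \<rho>/2 keeps r between \<rho>/2 and 2\<rho>, away from the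
    singularity of (N-1)/r at the origin.\<close>
  define h where "h = Min {\<delta>\<^sub>0, h\<^sub>0, \<rho> / 2}"
  have h: "0 < h" "h \<le> \<delta>\<^sub>0" "h \<le> h\<^sub>0" "h \<le> \<rho> / 2"
    using d0 h0 \<rho> by (auto simp: h_def)
  define lo hi where "lo = min \<rho> (\<rho> + \<sigma> * h)" and "hi = max \<rho> (\<rho> + \<sigma> * h)"
  have lo: "0 \<le> lo" using \<sigma> h \<rho> by (auto simp: lo_def)
  have S: "x \<in> {x\<in>\<Omega>. \<delta> x < \<delta>\<^sub>0}" if "lo < norm x" "norm x < hi" for x
  proof -
    have "0 < \<delta> x" "\<delta> x < h" using \<sigma> that h by (auto simp: \<delta>_def lo_def hi_def)
    then show ?thesis using \<Omega>[of x] h by (auto simp: \<delta>_def)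
  qed
  obtain b\<^sub>0 :: 'a where b0: "b\<^sub>0 \<in> Basis" using nonempty_Basis by blast
  define n where "n = real DIM('a) - 1"
  have n: "0 \<le> n" by (simp add: n_def Suc_le_eq)
  define r where "r t = \<rho> + \<sigma> * t" for t
  have r: "lo < r t" "r t < hi" "\<rho> / 2 \<le> r t" "r t \<le> 2 * \<rho>" "0 < r t" if "0 < t" "t < h" for t
    using that \<sigma> h \<rho> by (auto simp: r_def lo_def hi_def)
  have dr: "(r has_real_derivative \<sigma>) (at t)" for t
    unfolding r_def by (auto intro!: derivative_eq_intros)
  have \<sigma>\<sigma>: "\<sigma> * \<sigma> = 1" "\<sigma> * (\<sigma> * t) = t" for t using \<sigma> by auto
  have u: "u t = g (r t)" for t by (simp add: g_def r_def \<sigma>\<sigma>)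
  note lap = radial_laplacian[OF C2 lo S b0]
  show ?thesis
  \<comment> \<open>Here |P'/P| = n/r \<le> 2n/\<rho>; the summand 1 keeps \<open>A\<close> positive
    in dimension one, where n = 0.\<close>
  proof (rule no_intermediate_decay[OF p \<mu> h(1), where u\<^sub>1 = "\<lambda>t. deriv g (r t) * \<sigma>"
        and u\<^sub>2 = "\<lambda>t. deriv (deriv g) (r t)" and P = "\<lambda>t. r t powr n"
        and P\<^sub>1 = "\<lambda>t. n * r t powr (n - 1) * \<sigma>" and m = "(\<rho> / 2) powr n"
        and M = "(2 * \<rho>) powr n" and A = "2 * n / \<rho> + 1"])
    fix t assume t: "0 < t" "t < h"
    note rt = r[OF t]
    show "(u has_real_derivative deriv g (r t) * \<sigma>) (at t)"
      unfolding u by (rule DERIV_chain2[OF lap(1)[OF _ _ rt(1,2)] dr]) auto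
    show "((\<lambda>t. deriv g (r t) * \<sigma>) has_real_derivative deriv (deriv g) (r t)) (at t)"
      using DERIV_cmult_right[OF DERIV_chain2[OF lap(2)[OF _ _ rt(1,2)] dr], of \<sigma>]
      by (simp add: mult.assoc \<sigma>\<sigma>)
    show "((\<lambda>t. r t powr n) has_real_derivative n * r t powr (n - 1) * \<sigma>) (at t)"
      using rt by (auto intro!: derivative_eq_intros dr)
    show "(\<rho> / 2) powr n \<le> r t powr n" "r t powr n \<le> (2 * \<rho>) powr n"
      using rt n \<rho> by (auto intro!: powr_mono2)
    have powr_n: "r t powr (n - 1) = r t powr n / r t"
      using rt by (simp add: powr_diff)
    show "\<bar>n * r t powr (n - 1) * \<sigma>\<bar> \<le> (2 * n / \<rho> + 1) * r t powr n"
    proof -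
      have "n / r t \<le> n / (\<rho> / 2)" using rt n \<rho> by (intro divide_left_mono) auto
      also have "\<dots> \<le> 2 * n / \<rho> + 1" by (simp add: mult.commute)
      finally have "n / r t * r t powr n \<le> (2 * n / \<rho> + 1) * r t powr n"
        by (intro mult_right_mono) auto
      moreover have "\<bar>n * r t powr (n - 1) * \<sigma>\<bar> = n / r t * r t powr n"
        using \<sigma> n rt by (auto simp: powr_n abs_mult)
      ultimately show ?thesis by simp
    qed
    define x where "x = r t *\<^sub>R b\<^sub>0"
    have x: "norm x = r t" using b0 rt by (simp add: x_def)
    have \<delta>x: "\<delta> x = t" by (simp add: \<delta>_def x r_def \<sigma>\<sigma>)
    have "x \<in> {x\<in>\<Omega>. \<delta> x < \<delta>\<^sub>0}" using S x rt by simp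
    then have eqx: "0 < g (r t)"
      "laplacian (\<lambda>x. g (norm x)) x + \<mu> / t\<^sup>2 * g (r t) = g (r t) powr p"
      using eq[of x] by (auto simp: x \<delta>x)
    show "0 < u t" using eqx by (simp add: u)
    have "laplacian (\<lambda>x. g (norm x)) x = deriv (deriv g) (r t) + n / r t * deriv g (r t)"
      unfolding x_def n_def by (rule lap(3)[OF _ _ rt(1,2)]) auto
    moreover have "n * r t powr (n - 1) * \<sigma> / r t powr n * (deriv g (r t) * \<sigma>) =
        n / r t * deriv g (r t)"
      using rt \<sigma> by (auto simp: powr_n)
    ultimately show "deriv (deriv g) (r t) +
        n * r t powr (n - 1) * \<sigma> / r t powr n * (deriv g (r t) * \<sigma>) + \<mu> / t\<^sup>2 * u t = u t powr p"
      using eqx by (simp add: u)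
  next
    show "0 < (\<rho> / 2) powr n" using \<rho> by simp
    show "0 < 2 * n / \<rho> + 1" using n \<rho> by (intro add_nonneg_pos) auto
  qed
qed

section \<open>The three boundary configurations\<close>

theorem proposition2p3:
  fixes p \<mu> R r\<^sub>0 :: real
  assumes "0 < p" and "p < 1" and "\<mu> \<noteq> 0" and "\<mu> < 1/4"
    and "0 < r\<^sub>0" and "r\<^sub>0 < R"
  shows "(- mu_star p < \<mu> \<longleftrightarrow> beta_plus \<mu> < 2 / (1 - p)) \<and>
    (- mu_star p < \<mu> \<longrightarrow>
      (\<nexists>u. positive_radial_solution_near (ball (0 :: real ^ 'n) R) (delta_outer R) \<mu> p u \<and>
            intermediate_decay \<mu> p u) \<and>
      (\<nexists>u. positive_radial_solution_near (annulus r\<^sub>0 R :: (real ^ 'n) set) (delta_outer R) \<mu> p u \<and>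
            intermediate_decay \<mu> p u) \<and>
      (\<nexists>u. positive_radial_solution_near (annulus r\<^sub>0 R :: (real ^ 'n) set) (delta_inner r\<^sub>0) \<mu> p u \<and>
            intermediate_decay \<mu> p u))"
proof (intro conjI impI)
  show iff: "- mu_star p < \<mu> \<longleftrightarrow> beta_plus \<mu> < 2 / (1 - p)"
    using assms by (intro mu_star_less_iff) auto
  assume "- mu_star p < \<mu>"
  then have \<beta>: "beta_plus \<mu> < 2 / (1 - p)" using iff by simp
  have \<mu>: "\<mu> \<le> 1/4" and R: "0 < R" "0 < R - r\<^sub>0" using assms by auto
  have outer: "delta_outer R = (\<lambda>x :: real ^ 'n. - 1 * (norm x - R))"
    and inner: "delta_inner r\<^sub>0 = (\<lambda>x :: real ^ 'n. 1 * (norm x - r\<^sub>0))"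
    by (auto simp: delta_outer_def delta_inner_def)
  \<comment> \<open>The outer boundary is \<sigma> = -1, \<rho> = R, the inner one \<sigma> = 1,
    \<rho> = \<open>r\<^sub>0\<close>. Width \<open>R - r\<^sub>0\<close> keeps the strip inside the
    annulus; for the ball any positive width works, and 1 is taken.\<close>
  note no_decay = no_radial_intermediate_decay[OF assms(1,2) \<mu> \<beta>]
  show "\<nexists>u. positive_radial_solution_near (ball (0 :: real ^ 'n) R) (delta_outer R) \<mu> p u \<and>
      intermediate_decay \<mu> p u"
    using no_decay[of "- 1" R 1 "ball (0 :: real ^ 'n) R"] R unfolding outer by auto
  show "\<nexists>u. positive_radial_solution_near (annulus r\<^sub>0 R :: (real ^ 'n) set) (delta_outer R) \<mu> p u \<and>
      intermediate_decay \<mu> p u"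
    using no_decay[of "- 1" R "R - r\<^sub>0" "annulus r\<^sub>0 R :: (real ^ 'n) set"] R
    unfolding outer by (auto simp: annulus_def)
  show "\<nexists>u. positive_radial_solution_near (annulus r\<^sub>0 R :: (real ^ 'n) set) (delta_inner r\<^sub>0) \<mu> p u \<and>
      intermediate_decay \<mu> p u"
    using no_decay[of 1 r\<^sub>0 "R - r\<^sub>0" "annulus r\<^sub>0 R :: (real ^ 'n) set"] R assms(5)
    unfolding inner by (auto simp: annulus_def)
qed

end
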